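(* Let $\alpha>-1$. For every integer $n\ge0$ and every $x\in\mathbb{R}$, $$\lim_{c\to1}M_n\!\left(\frac{cx}{1-c};\alpha+1,c\right)=\frac{L_n^{(\alpha)}(x)}{L_n^{(\alpha)}(0)},$$ where $M_n(\cdot\,;\beta,c)$ are the Meixner polynomials and $L_n^{(\alpha)}$ the generalized Laguerre polynomials.
   Context: The Meixner polynomials are defined by the generating function $\left(1-\frac zc\right)^x(1-z)^{-\beta-x}=\sum_{n=0}^\infty\frac{(\beta)_n}{n!}M_n(x;\beta,c)z^n$ for $z$ near $0$, where $(\beta)_n=\prod_{i=1}^n(\beta+i-1)$, $(\beta)_0=1$. The generalized Laguerre polynomials are defined by $(1-z)^{-\alpha-1}e^{-\frac{zx}{1-z}}=\sum_{n=0}^\infty L_n^{(\alpha)}(x)z^n$, $|z|<1$. *)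

theory Defs
  imports "HOL-Analysis.Analysis" "HOL-Complex_Analysis.Complex_Analysis"
begin

text \<open>
  Both families are defined by their generating functions, at a real argument \<open>x\<close> and as
  identities in a real variable \<open>z\<close>: near \<open>0\<close> all bases of powers are then positive, so that
  \<^const>\<open>powr\<close> is the real power, and a power series identity on a real neighbourhood of \<open>0\<close>
  already determines all coefficients.
\<close>

text \<open>
  The rising factorial \<open>(\<beta>)\<^sub>n\<close> is \<^const>\<open>pochhammer\<close>. The description is meaningful for \<open>c \<noteq> 0\<close> and
  \<open>\<beta>\<close> not in \<open>{0, -1, -2, \<dots>}\<close>; see \<open>meixner_generating_function\<close> below. There is no restriction to
  \<open>c < 1\<close>.
\<close>

definition meixner :: "nat \<Rightarrow> real \<Rightarrow> real \<Rightarrow> real \<Rightarrow> real" where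
  "meixner n x \<beta> c =
     (THE M :: nat \<Rightarrow> real.
        \<forall>\<^sub>F z in nhds 0.
          (\<lambda>k. pochhammer \<beta> k / fact k * M k * z ^ k) sums
            ((1 - z / c) powr x * (1 - z) powr (- \<beta> - x))) n"

definition laguerre :: "nat \<Rightarrow> real \<Rightarrow> real \<Rightarrow> real" where
  "laguerre n \<alpha> x =
     (THE L :: nat \<Rightarrow> real.
        \<forall>z. \<bar>z\<bar> < 1 \<longrightarrow>
          (\<lambda>k. L k * z ^ k) sums ((1 - z) powr (- \<alpha> - 1) * exp (- (z * x / (1 - z))))) n"

text \<open>
  The remaining lemmas show that the definite descriptions denote, so that the two functions do
  satisfy the generating function identities.
\<close>

lemma real_power_series_unique:
  fixes a b :: "nat \<Rightarrow> real"
  assumes "\<forall>\<^sub>F z in nhds 0. (\<lambda>k. a k * z ^ k) sums f z"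
    and "\<forall>\<^sub>F z in nhds 0. (\<lambda>k. b k * z ^ k) sums f z"
  shows "a = b"
proof (rule ccontr)
  assume "a \<noteq> b"
  then obtain m where m: "a m - b m \<noteq> 0" by auto
  have ev: "\<forall>\<^sub>F z in nhds 0. (\<lambda>k. (a k - b k) * z ^ k) sums 0"
    using assms
  proof eventually_elim
    case (elim z)
    from sums_diff[OF elim] show ?case by (simp add: algebra_simps)
  qed
  then obtain r where r: "r > 0"
    and s: "\<And>z. \<bar>z\<bar> < r \<Longrightarrow> (\<lambda>k. (a k - b k) * z ^ k) sums 0"
    unfolding eventually_nhds_metric by (auto simp: dist_real_def)
  have "a 0 - b 0 = 0"
    using s[of 0] r powser_sums_zero_iff[of "\<lambda>k. a k - b k" 0] by simp
  with m have "m > 0" by (metis gr0I)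
  obtain s' where s': "s' > 0" and nz: "\<And>z. z \<in> cball 0 s' - {0::real} \<Longrightarrow> (0::real) \<noteq> 0"
    by (rule powser_0_nonzero[OF r, of 0 "\<lambda>k. a k - b k" "\<lambda>_. 0" m])
      (use s m \<open>m > 0\<close> in auto)
  from nz[of s'] s' show False by auto
qed

lemma real_power_series_exists:
  fixes g :: "real \<Rightarrow> real" and f :: "complex \<Rightarrow> complex"
  assumes "f holomorphic_on ball 0 r"
    and "\<And>z. \<bar>z\<bar> < r \<Longrightarrow> f (of_real z) = of_real (g z)"
  obtains a where "\<And>z. \<bar>z\<bar> < r \<Longrightarrow> (\<lambda>k. a k * z ^ k) sums g z"
proof
  fix z :: real
  assume z: "\<bar>z\<bar> < r"
  have "(\<lambda>k. (deriv ^^ k) f 0 / fact k * (of_real z - 0) ^ k) sums f (of_real z)"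
    by (rule holomorphic_power_series[OF assms(1)]) (use z in auto)
  then have "(\<lambda>k. (deriv ^^ k) f 0 / fact k * of_real (z ^ k)) sums of_real (g z)"
    using assms(2)[OF z] by simp
  then have "(\<lambda>k. Re ((deriv ^^ k) f 0 / fact k * of_real (z ^ k))) sums Re (of_real (g z))"
    by (rule sums_Re)
  then show "(\<lambda>k. Re ((deriv ^^ k) f 0 / fact k) * z ^ k) sums g z"
    by (simp only: Re_complex_of_real times_complex.sel complex.sel Im_complex_of_real mult_zero_right diff_zero)
qed

lemma one_minus_notin_nonpos_Reals:
  assumes "norm (z :: complex) < 1"
  shows "1 - z \<notin> \<real>\<^sub>\<le>\<^sub>0"
  using assms abs_Re_le_cmod[of z] by (auto simp: complex_nonpos_Reals_iff)

lemma meixner_generating_function: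
  assumes c: "c \<noteq> 0" and \<beta>: "\<And>k. pochhammer \<beta> k \<noteq> 0"
  shows "\<forall>\<^sub>F z in nhds 0.
           (\<lambda>k. pochhammer \<beta> k / fact k * meixner k x \<beta> c * z ^ k) sums
             ((1 - z / c) powr x * (1 - z) powr (- \<beta> - x))"
proof -
  define P where "P = (\<lambda>M :: nat \<Rightarrow> real. \<forall>\<^sub>F z in nhds 0.
     (\<lambda>k. pochhammer \<beta> k / fact k * M k * z ^ k) sums
       ((1 - z / c) powr x * (1 - z) powr (- \<beta> - x)))"
  define r where "r = min 1 \<bar>c\<bar>"
  have r: "r > 0" using c by (simp add: r_def)
  have lt: "norm (z / of_real c) < 1" if "norm z < r" for z :: complex
    using that c by (simp add: r_def norm_divide)
  obtain a where a: "\<And>z. \<bar>z\<bar> < r \<Longrightarrow>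
      (\<lambda>k. a k * z ^ k) sums ((1 - z / c) powr x * (1 - z) powr (- \<beta> - x))"
  proof (rule real_power_series_exists)
    show "(\<lambda>z. (1 - z / of_real c) powr of_real x * (1 - z) powr of_real (- \<beta> - x))
            holomorphic_on ball 0 r"
      by (intro holomorphic_intros one_minus_notin_nonpos_Reals lt)
        (use c in \<open>auto simp: r_def\<close>)
  next
    fix z :: real
    assume z: "\<bar>z\<bar> < r"
    have "\<bar>z / c\<bar> < 1" using z c by (simp add: r_def)
    then have "1 - z / c \<ge> 0" by linarith
    moreover have "1 - z \<ge> 0" using z unfolding r_def by linarith
    ultimately show "(1 - of_real z / of_real c) powr of_real x
        * (1 - of_real z) powr of_real (- \<beta> - x)
      = complex_of_real ((1 - z / c) powr x * (1 - z) powr (- \<beta> - x))"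
      by (simp add: powr_of_real[symmetric])
  qed blast
  have "P (\<lambda>k. a k * fact k / pochhammer \<beta> k)"
    unfolding P_def eventually_nhds_metric using a r \<beta>
    by (auto simp: dist_real_def intro!: exI[of _ r])
  moreover have "M = M'" if "P M" "P M'" for M M'
    using real_power_series_unique[OF that[unfolded P_def]] \<beta>
    by (auto simp: fun_eq_iff)
  ultimately have "P (THE M. P M)" by (metis theI)
  then show ?thesis by (simp add: P_def meixner_def)
qed

lemma laguerre_generating_function:
  assumes "\<bar>z\<bar> < 1"
  shows "(\<lambda>k. laguerre k \<alpha> x * z ^ k) sums
           ((1 - z) powr (- \<alpha> - 1) * exp (- (z * x / (1 - z))))"
proof -
  define P where "P = (\<lambda>L :: nat \<Rightarrow> real. \<forall>z. \<bar>z\<bar> < 1 \<longrightarrow>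
     (\<lambda>k. L k * z ^ k) sums ((1 - z) powr (- \<alpha> - 1) * exp (- (z * x / (1 - z)))))"
  obtain a where a: "\<And>z. \<bar>z\<bar> < 1 \<Longrightarrow>
      (\<lambda>k. a k * z ^ k) sums ((1 - z) powr (- \<alpha> - 1) * exp (- (z * x / (1 - z))))"
  proof (rule real_power_series_exists)
    show "(\<lambda>z. (1 - z) powr of_real (- \<alpha> - 1) * exp (- (z * of_real x / (1 - z))))
            holomorphic_on ball 0 1"
      by (intro holomorphic_intros one_minus_notin_nonpos_Reals) auto
  next
    fix z :: real
    assume z: "\<bar>z\<bar> < 1"
    then have "1 - z \<ge> 0" by linarith
    then show "(1 - of_real z) powr of_real (- \<alpha> - 1)
        * exp (- (of_real z * of_real x / (1 - of_real z)))
      = complex_of_real ((1 - z) powr (- \<alpha> - 1) * exp (- (z * x / (1 - z))))"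
      by (simp add: powr_of_real[symmetric] exp_of_real[symmetric])
  qed blast
  have "P a" using a by (simp add: P_def)
  moreover have "L = L'" if "P L" "P L'" for L L'
  proof (rule real_power_series_unique)
    have *: "\<forall>\<^sub>F z in nhds (0::real). \<bar>z\<bar> < 1"
      unfolding eventually_nhds_metric by (auto simp: dist_real_def intro!: exI[of _ 1])
    show "\<forall>\<^sub>F z in nhds 0. (\<lambda>k. L k * z ^ k) sums
        ((1 - z) powr (- \<alpha> - 1) * exp (- (z * x / (1 - z))))"
      using * by eventually_elim (use that in \<open>simp add: P_def\<close>)
    show "\<forall>\<^sub>F z in nhds 0. (\<lambda>k. L' k * z ^ k) sums
        ((1 - z) powr (- \<alpha> - 1) * exp (- (z * x / (1 - z))))"
      using * by eventually_elim (use that in \<open>simp add: P_def\<close>)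
  qed
  ultimately have "P (THE L. P L)" by (metis theI)
  with assms show ?thesis by (simp add: P_def laguerre_def)
qed

end

theory Submission
  imports Defs
begin

text \<open>
  Substituting \<open>cx / (1 - c)\<close> into the Meixner generating function gives a function whose
  two exponents blow up as \<open>c \<rightarrow> 1\<close> if \<open>x \<noteq> 0\<close>. Its logarithmic derivative, however, is harmless: with
  \<open>X = cx / (1 - c)\<close> and \<open>F z = (1 - z/c)\<^sup>X (1 - z)\<^sup>-\<^sup>\<beta>\<^sup>-\<^sup>X\<close>,

    \<open>F' z / F z = - X / (c - z) + (\<beta> + X) / (1 - z) = (\<beta> (c - z) - c x) / ((c - z) (1 - z))\<close>,

  because \<open>X (c - z) - X (1 - z) = - c x\<close>. The factor \<open>1 - c\<close> has cancelled, and at \<open>c = 1\<close> the right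
  side is the logarithmic derivative of the Laguerre generating function with \<open>\<beta> = \<alpha> + 1\<close>. So both
  generating functions solve members of one family of differential equations that is continuous
  in \<open>c\<close> (lemmas \<open>meixner_generating_function_ode\<close> and \<open>laguerre_generating_function_ode\<close>).

  On power series coefficients this equation is a three-term recurrence whose leading coefficient
  \<open>c (n + 1)\<close> does not vanish near \<open>c = 1\<close> (lemma \<open>power_series_ode_recurrence\<close>). As both expansions
  start with \<open>1\<close>, induction on \<open>n\<close> shows that the coefficient \<open>(\<beta>)\<^sub>n / n! M\<^sub>n\<close> tends to \<open>L\<^sub>n x\<close>.
  The normalising factor is \<open>L\<^sub>n 0 = (\<beta>)\<^sub>n / n!\<close>, by the binomial series.
\<close>

lemma has_fps_expansion_iff_sums:
  fixes f :: "real \<Rightarrow> real"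
  shows "f has_fps_expansion F \<longleftrightarrow> (\<forall>\<^sub>F z in nhds 0. (\<lambda>k. fps_nth F k * z ^ k) sums f z)"
proof
  assume F: "f has_fps_expansion F"
  then have "\<forall>\<^sub>F z in nhds 0. z \<in> eball 0 (fps_conv_radius F)"
    by (intro eventually_nhds_in_open) (auto simp: has_fps_expansion_def zero_ereal_def)
  moreover have "\<forall>\<^sub>F z in nhds 0. eval_fps F z = f z"
    using F by (simp add: has_fps_expansion_def)
  ultimately show "\<forall>\<^sub>F z in nhds 0. (\<lambda>k. fps_nth F k * z ^ k) sums f z"
  proof eventually_elim
    case (elim z)
    then show ?case using sums_eval_fps[of z F] by simp
  qed
next
  assume *: "\<forall>\<^sub>F z in nhds 0. (\<lambda>k. fps_nth F k * z ^ k) sums f z"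
  then obtain r where r: "r > 0" and s: "\<And>z. \<bar>z\<bar> < r \<Longrightarrow> (\<lambda>k. fps_nth F k * z ^ k) sums f z"
    unfolding eventually_nhds_metric by (auto simp: dist_real_def)
  have "ereal (norm (r / 2)) \<le> fps_conv_radius F"
    unfolding fps_conv_radius_def
    by (rule conv_radius_geI, rule sums_summable, rule s) (use r in auto)
  then have "fps_conv_radius F > 0"
    using r by (auto intro: less_le_trans[of _ "ereal (norm (r / 2))"])
  moreover have "\<forall>\<^sub>F z in nhds 0. eval_fps F z = f z"
    using * by eventually_elim (simp add: eval_fps_def sums_iff)
  ultimately show "f has_fps_expansion F" by (simp add: has_fps_expansion_def)
qed

text \<open>
  Expanded in powers of \<open>z\<close>, the differential equation is a relation between formal power series,
  and comparing the coefficients of \<open>z\<^sup>n\<close> gives the recurrence.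
\<close>

lemma power_series_ode_recurrence:
  fixes a :: "nat \<Rightarrow> real" and f f' :: "real \<Rightarrow> real"
  assumes sums: "\<forall>\<^sub>F z in nhds 0. (\<lambda>k. a k * z ^ k) sums f z"
    and deriv: "\<forall>\<^sub>F z in nhds 0. (f has_real_derivative f' z) (at z)"
    and ode: "\<forall>\<^sub>F z in nhds 0. (c - z) * (1 - z) * f' z = (\<beta> * (c - z) - c * x) * f z"
  shows "c * (real n + 1) * a (Suc n) =
    ((1 + c) * real n + \<beta> * c - c * x) * a n
      - (if n = 0 then 0 else (real n - 1 + \<beta>) * a (n - 1))"
proof -
  define A where "A = Abs_fps a"
  have A: "f has_fps_expansion A"
    using sums by (simp add: has_fps_expansion_iff_sums A_def)
  define L where "L = fps_const c * fps_deriv A - fps_const (1 + c) * (fps_X * fps_deriv A)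
    + fps_X * (fps_X * fps_deriv A)"
  define R where "R = fps_const (\<beta> * c - c * x) * A - fps_const \<beta> * (fps_X * A)"
  have L: "(\<lambda>z. c * deriv f z - (1 + c) * (z * deriv f z) + z * (z * deriv f z))
      has_fps_expansion L"
    unfolding L_def by (intro fps_expansion_intros A)
  have R: "(\<lambda>z. (\<beta> * c - c * x) * f z - \<beta> * (z * f z)) has_fps_expansion R"
    unfolding R_def by (intro fps_expansion_intros A)
  have "\<forall>\<^sub>F z in nhds 0. c * deriv f z - (1 + c) * (z * deriv f z) + z * (z * deriv f z)
      = (\<beta> * c - c * x) * f z - \<beta> * (z * f z)"
    using deriv ode
  proof eventually_elim
    case (elim z)
    then show ?case by (simp add: DERIV_imp_deriv algebra_simps)
  qed
  from has_fps_expansion_cong[OF this refl, of L] L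
  have L': "(\<lambda>z. (\<beta> * c - c * x) * f z - \<beta> * (z * f z)) has_fps_expansion L" by simp
  have "fps_nth L = fps_nth R"
    by (rule real_power_series_unique[OF L'[unfolded has_fps_expansion_iff_sums]
          R[unfolded has_fps_expansion_iff_sums]])
  then have "fps_nth L n = fps_nth R n" by simp
  then show ?thesis
    by (cases n; cases "n - 1") (auto simp: L_def R_def A_def algebra_simps)
qed

text \<open>
  The poles at \<open>c\<close> and \<open>1\<close> of the logarithmic derivative have residues \<open>X\<close> and \<open>- \<beta> - X\<close>. Over a
  common denominator \<open>X\<close> occurs only in the product \<open>X (1 - c) = c x\<close>, so that the equation stays
  regular as \<open>c \<rightarrow> 1\<close>.
\<close>

lemma meixner_generating_function_ode:
  fixes c x \<beta> :: real
  defines "X \<equiv> c * x / (1 - c)"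
  defines "f \<equiv> \<lambda>z. (1 - z / c) powr X * (1 - z) powr (- \<beta> - X)"
  defines "f' \<equiv> \<lambda>z. (\<beta> * (c - z) - c * x) / ((c - z) * (1 - z)) * f z"
  assumes c: "c > 0" "c \<noteq> 1"
  shows "\<forall>\<^sub>F z in nhds 0. (f has_real_derivative f' z) (at z)"
    and "\<forall>\<^sub>F z in nhds 0. (c - z) * (1 - z) * f' z = (\<beta> * (c - z) - c * x) * f z"
proof -
  have ev: "\<forall>\<^sub>F z in nhds (0::real). z < c \<and> z < 1"
    by (rule eventually_mono[OF eventually_nhds_in_open[of "{..<min c 1}"]]) (use c in auto)
  show "\<forall>\<^sub>F z in nhds 0. (f has_real_derivative f' z) (at z)"
    using ev
  proof eventually_elim
    case (elim z)
    then have pos: "1 - z / c > 0" "1 - z > 0" using c by (auto simp: field_simps)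
    \<comment> \<open>The logarithmic terms vanish because the exponents are constant; they are kept because the
      derivative rule for \<^const>\<open>powr\<close> produces them.\<close>
    have "(f has_real_derivative
        (1 - z / c) powr X * (0 * ln (1 - z / c) + (- 1 / c) * X / (1 - z / c))
            * (1 - z) powr (- \<beta> - X)
          + (1 - z) powr (- \<beta> - X) * (0 * ln (1 - z) + (- 1) * (- \<beta> - X) / (1 - z))
            * (1 - z / c) powr X) (at z)"
      unfolding f_def
      by (intro DERIV_mult DERIV_powr) (use pos c in \<open>auto intro!: derivative_eq_intros\<close>)
    also have "(1 - z / c) powr X * (0 * ln (1 - z / c) + (- 1 / c) * X / (1 - z / c))
            * (1 - z) powr (- \<beta> - X)
          + (1 - z) powr (- \<beta> - X) * (0 * ln (1 - z) + (- 1) * (- \<beta> - X) / (1 - z))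
            * (1 - z / c) powr X
        = ((- 1 / c) * X / (1 - z / c) + (- 1) * (- \<beta> - X) / (1 - z)) * f z"
      unfolding f_def by algebra
    also have "(- 1 / c) * X / (1 - z / c) = - X / (c - z)"
      using c pos by (simp add: field_simps)
    also have "(- 1) * (- \<beta> - X) / (1 - z) = (\<beta> + X) / (1 - z)"
      by simp
    also have "- X / (c - z) + (\<beta> + X) / (1 - z)
        = (\<beta> * (c - z) - X * (1 - c)) / ((c - z) * (1 - z))"
      using elim by (simp add: divide_simps) (simp add: algebra_simps)
    also have "X * (1 - c) = c * x" using c by (simp add: X_def)
    finally show ?case by (simp add: f'_def)
  qed
  show "\<forall>\<^sub>F z in nhds 0. (c - z) * (1 - z) * f' z = (\<beta> * (c - z) - c * x) * f z"
    using ev by eventually_elim (simp add: f'_def)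
qed

text \<open>
  At \<open>c = 1\<close> the two simple poles of the Meixner case have merged into a double pole, which is what
  the essential singularity of \<open>exp (- z x / (1 - z))\<close> contributes. The constants \<open>1\<close> are kept in
  place of \<open>c\<close> so that the equation is literally that instance of the family.
\<close>

lemma laguerre_generating_function_ode:
  fixes x \<beta> :: real
  defines "f \<equiv> \<lambda>z. (1 - z) powr (- \<beta>) * exp (- (z * x / (1 - z)))"
  defines "f' \<equiv> \<lambda>z. (\<beta> * (1 - z) - x) / ((1 - z) * (1 - z)) * f z"
  shows "\<forall>\<^sub>F z in nhds 0. (f has_real_derivative f' z) (at z)"
    and "\<forall>\<^sub>F z in nhds 0. (1 - z) * (1 - z) * f' z = (\<beta> * (1 - z) - 1 * x) * f z"
proof -
  have ev: "\<forall>\<^sub>F z in nhds (0::real). z < 1"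
    by (rule eventually_mono[OF eventually_nhds_in_open[of "{..<1}"]]) auto
  show "\<forall>\<^sub>F z in nhds 0. (f has_real_derivative f' z) (at z)"
    using ev
  proof eventually_elim
    case (elim z)
    have 1: "((\<lambda>z. (1 - z) powr (- \<beta>)) has_real_derivative
        (1 - z) powr (- \<beta>) * (0 * ln (1 - z) + (- 1) * (- \<beta>) / (1 - z))) (at z)"
      by (intro DERIV_powr) (use elim in \<open>auto intro!: derivative_eq_intros\<close>)
    have 2: "((\<lambda>z. exp (- (z * x / (1 - z)))) has_real_derivative
        exp (- (z * x / (1 - z))) * (- x / ((1 - z) * (1 - z)))) (at z)"
      using elim by (auto intro!: derivative_eq_intros simp: field_simps)
    have "(1 - z) powr (- \<beta>) * (0 * ln (1 - z) + (- 1) * (- \<beta>) / (1 - z))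
            * exp (- (z * x / (1 - z)))
          + exp (- (z * x / (1 - z))) * (- x / ((1 - z) * (1 - z))) * (1 - z) powr (- \<beta>)
        = ((- 1) * (- \<beta>) / (1 - z) + - x / ((1 - z) * (1 - z))) * f z"
      unfolding f_def by algebra
    also have "(- 1) * (- \<beta>) / (1 - z) + - x / ((1 - z) * (1 - z)) = (\<beta> * (1 - z) - x) / ((1 - z) * (1 - z))"
      using elim by (simp add: diff_divide_distrib)
    finally show ?case
      using DERIV_mult[OF 1 2] by (simp add: f_def f'_def)
  qed
  show "\<forall>\<^sub>F z in nhds 0. (1 - z) * (1 - z) * f' z = (\<beta> * (1 - z) - 1 * x) * f z"
    using ev by eventually_elim (simp add: f'_def)
qed

lemma eventually_abs_less_1: "\<forall>\<^sub>F z in nhds (0::real). \<bar>z\<bar> < 1"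
  unfolding eventually_nhds_metric by (auto simp: dist_real_def intro!: exI[of _ 1])

lemma eventually_laguerre_sums:
  "\<forall>\<^sub>F z in nhds 0. (\<lambda>k. laguerre k \<alpha> x * z ^ k) sums
     ((1 - z) powr (- (\<alpha> + 1)) * exp (- (z * x / (1 - z))))"
  using eventually_abs_less_1
proof eventually_elim
  case (elim z)
  have "- (\<alpha> + 1) = - \<alpha> - 1" by simp
  then show ?case using laguerre_generating_function[OF elim, of \<alpha> x] by (simp only:)
qed

text \<open>At \<open>x = 0\<close> the Laguerre generating function is the binomial series of \<open>(1 - z)\<^sup>-\<^sup>\<alpha>\<^sup>-\<^sup>1\<close>.\<close>

lemma laguerre_at_0: "laguerre n \<alpha> 0 = pochhammer (\<alpha> + 1) n / fact n"
proof -
  have "\<forall>\<^sub>F z in nhds 0. (\<lambda>k. pochhammer (\<alpha> + 1) k / fact k * z ^ k) sums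
      ((1 - z) powr (- (\<alpha> + 1)) * exp (- (z * 0 / (1 - z))))"
    using eventually_abs_less_1
  proof eventually_elim
    case (elim z)
    have "(- (\<alpha> + 1) gchoose k) * (- z) ^ k = pochhammer (\<alpha> + 1) k / fact k * z ^ k" for k
    proof -
      have sign: "(- 1) ^ k * (- z) ^ k = z ^ k" by (simp flip: power_mult_distrib)
      have "(- (\<alpha> + 1) gchoose k) * (- z) ^ k
          = pochhammer (\<alpha> + 1) k / fact k * ((- 1) ^ k * (- z) ^ k)"
        by (subst gbinomial_pochhammer) (simp only: minus_minus divide_inverse mult_ac)
      then show ?thesis unfolding sign .
    qed
    then show ?case
      using gen_binomial_real[of "- z" "- (\<alpha> + 1)"] elim by simp
  qed
  from real_power_series_unique[OF eventually_laguerre_sums[of \<alpha> 0] this]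
  show ?thesis by (rule fun_cong)
qed

text \<open>
  Induction on the recurrence. It may be solved for the coefficient of index \<open>n + 1\<close>, since its
  leading coefficient \<open>c (n + 1)\<close> tends to \<open>n + 1 \<noteq> 0\<close>.
\<close>

lemma recurrence_tendsto:
  fixes a :: "real \<Rightarrow> nat \<Rightarrow> real" and b :: "nat \<Rightarrow> real" and \<beta> x :: real
  defines "rhs \<equiv> \<lambda>c s n. ((1 + c) * real n + \<beta> * c - c * x) * s n
      - (if n = 0 then 0 else (real n - 1 + \<beta>) * s (n - 1 :: nat))"
  assumes a0: "\<forall>\<^sub>F c in at 1. a c 0 = b 0"
    and a: "\<And>n. \<forall>\<^sub>F c in at 1. c * (real n + 1) * a c (Suc n) = rhs c (a c) n"
    and b: "\<And>n. 1 * (real n + 1) * b (Suc n) = rhs 1 b n"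
  shows "((\<lambda>c. a c n) \<longlongrightarrow> b n) (at 1)"
proof (induction n rule: less_induct)
  case (less n)
  show ?case
  proof (cases n)
    case 0
    then show ?thesis using a0 by (simp add: tendsto_eventually)
  next
    case (Suc m)
    have 1: "((\<lambda>c. a c m) \<longlongrightarrow> b m) (at 1)" using less Suc by simp
    have 2: "((\<lambda>c. if m = 0 then 0 else (real m - 1 + \<beta>) * a c (m - 1)) \<longlongrightarrow>
        (if m = 0 then 0 else (real m - 1 + \<beta>) * b (m - 1))) (at 1)"
      using less Suc by (auto intro!: tendsto_intros)
    have "((\<lambda>c. rhs c (a c) m / (c * (real m + 1))) \<longlongrightarrow> rhs 1 b m / (1 * (real m + 1))) (at 1)"
      unfolding rhs_def by (intro tendsto_intros 1 2) auto
    also have "rhs 1 b m / (1 * (real m + 1)) = b n"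
      using b[of m] by (simp add: Suc field_simps)
    finally have lim: "((\<lambda>c. rhs c (a c) m / (c * (real m + 1))) \<longlongrightarrow> b n) (at 1)" .
    have "\<forall>\<^sub>F c in at (1::real). c > 0"
      by (rule order_tendstoD(1)[OF tendsto_ident_at]) simp
    then have "\<forall>\<^sub>F c in at 1. rhs c (a c) m / (c * (real m + 1)) = a c n"
      using a[of m]
    proof eventually_elim
      case (elim c)
      have "rhs c (a c) m / (c * (real m + 1)) = c * (real m + 1) * a c n / (c * (real m + 1))"
        using elim(2) Suc by simp
      then show ?case using elim(1) by simp
    qed
    with lim show ?thesis by (rule Lim_transform_eventually)
  qed
qed

theorem corollary5p3:
  fixes \<alpha> x :: real and n :: nat
  assumes "\<alpha> > -1"
  shows "((\<lambda>c. meixner n (c * x / (1 - c)) (\<alpha> + 1) c)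
            \<longlongrightarrow> laguerre n \<alpha> x / laguerre n \<alpha> 0) (at 1)"
proof -
  define \<beta> where "\<beta> = \<alpha> + 1"
  have poch: "pochhammer \<beta> k > 0" for k using assms by (intro pochhammer_pos) (simp add: \<beta>_def)
  define a where "a = (\<lambda>c k. pochhammer \<beta> k / fact k * meixner k (c * x / (1 - c)) \<beta> c)"
  have pos: "\<forall>\<^sub>F c in at (1::real). c > 0"
    by (rule order_tendstoD(1)[OF tendsto_ident_at]) simp
  have ne: "\<forall>\<^sub>F c in at (1::real). c \<noteq> 1" by (simp add: eventually_at_filter)
  have sums: "\<forall>\<^sub>F z in nhds 0. (\<lambda>k. a c k * z ^ k) sums
      ((1 - z / c) powr (c * x / (1 - c)) * (1 - z) powr (- \<beta> - c * x / (1 - c)))"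
    if "c > 0" for c
    using meixner_generating_function[of c \<beta>] that poch by (simp add: a_def less_imp_neq[symmetric])
  have "((\<lambda>c. a c n) \<longlongrightarrow> laguerre n \<alpha> x) (at 1)"
  proof (rule recurrence_tendsto[where \<beta> = \<beta> and x = x])
    have "laguerre 0 \<alpha> x = 1"
      using eventually_nhds_x_imp_x[OF eventually_laguerre_sums[of \<alpha> x]]
        powser_sums_zero_iff[of "\<lambda>k. laguerre k \<alpha> x"] by simp
    moreover have "a c 0 = 1" if "c > 0" for c
      using eventually_nhds_x_imp_x[OF sums[OF that]] powser_sums_zero_iff[of "a c"] by simp
    ultimately show "\<forall>\<^sub>F c in at 1. a c 0 = laguerre 0 \<alpha> x"
      using pos by (auto elim!: eventually_mono)
  next
    fix m
    show "\<forall>\<^sub>F c in at 1. c * (real m + 1) * a c (Suc m) =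
        ((1 + c) * real m + \<beta> * c - c * x) * a c m
          - (if m = 0 then 0 else (real m - 1 + \<beta>) * a c (m - 1))"
      using pos ne
    proof eventually_elim
      case (elim c)
      show ?case
        by (rule power_series_ode_recurrence[OF sums meixner_generating_function_ode]) fact+
    qed
  next
    fix m
    show "1 * (real m + 1) * laguerre (Suc m) \<alpha> x =
        ((1 + 1) * real m + \<beta> * 1 - 1 * x) * laguerre m \<alpha> x
          - (if m = 0 then 0 else (real m - 1 + \<beta>) * laguerre (m - 1) \<alpha> x)"
      unfolding \<beta>_def
      by (rule power_series_ode_recurrence[OF eventually_laguerre_sums
            laguerre_generating_function_ode])
  qed
  then have "((\<lambda>c. a c n / (pochhammer \<beta> n / fact n)) \<longlongrightarrow>
      laguerre n \<alpha> x / (pochhammer \<beta> n / fact n)) (at 1)"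
    using poch[of n] by (intro tendsto_divide tendsto_const) auto
  then show ?thesis
    using poch[of n] by (simp add: a_def laguerre_at_0 \<beta>_def)
qed

end
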